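(* Let $G$ be a nontrivial traceable graph and let $H$ be a connected graph whose maximum degree equals $|V(H)|-2$. Then $tpc(G\square H)=3$.
   Context: All graphs are simple, finite and undirected. A graph is traceable if it has a Hamiltonian path (a path containing every vertex); nontrivial means having at least two vertices. A graph is total-colored if all its vertices and edges are assigned colors. A path in a total-colored graph is a total proper path if (i) any two adjacent edges on the path differ in color, (ii) any two adjacent internal vertices of the path differ in color, and (iii) every internal vertex of the path differs in color from the edges of the path incident with it. A total-colored graph is total-proper connected if any two vertices are joined by a total proper path. For a connected graph $G$, $tpc(G)$ is the smallest number of colors in a total-coloring making $G$ total-proper connected. The Cartesian product $G\square H$ has vertex set $V(G)\times V(H)$, with $(g,h)$ adjacent to $(g',h')$ iff either $g=g'$ and $hh'\in E(H)$, or $h=h'$ and $gg'\in E(G)$. *)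

theory Defs
  imports "Graph_Theory.Graph_Theory"
begin

text \<open>
  A finite simple undirected graph is a \<^locale>\<open>pair_graph\<close>: a finite vertex set with a
  symmetric irreflexive set of arcs. The undirected edge joining \<open>u\<close> and \<open>v\<close> is the set \<open>{u, v}\<close>,
  so that a colouring of edges does not depend on the direction of the arcs.
\<close>

definition uedges :: "'a pair_pre_digraph \<Rightarrow> 'a set set" where
  "uedges G = {{u, v} | u v. (u, v) \<in> parcs G}"

text \<open>In a symmetric digraph the out-degree is the degree of the undirected graph.\<close>

definition max_degree :: "'a pair_pre_digraph \<Rightarrow> nat" where
  "max_degree G = Max (out_degree G ` pverts G)"

definition traceable :: "'a pair_pre_digraph \<Rightarrow> bool" where
  "traceable G \<longleftrightarrow> (\<exists>p. vpath p G \<and> set p = pverts G)"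

definition cart_prod ::
  "'a pair_pre_digraph \<Rightarrow> 'b pair_pre_digraph \<Rightarrow> ('a \<times> 'b) pair_pre_digraph" where
  "cart_prod G H =
    \<lparr> pverts = pverts G \<times> pverts H,
      parcs = {((g, h), (g', h')). (g, h) \<in> pverts G \<times> pverts H \<and> (g', h') \<in> pverts G \<times> pverts H \<and>
        (g = g' \<and> (h, h') \<in> parcs H \<or> h = h' \<and> (g, g') \<in> parcs G)} \<rparr>"

text \<open>
  A total-colouring is given by a colouring \<open>cv\<close> of the vertices and a colouring \<open>ce\<close> of the
  edges, with a common set of colours; no properness is required. The internal vertices of the path
  \<open>p\<close> are the \<open>p ! i\<close> with \<open>0 < i\<close> and \<open>i + 1 < length p\<close>; adjacency of edges and of internal
  vertices is adjacency on the path.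
\<close>

definition total_proper_path :: "('a \<Rightarrow> nat) \<Rightarrow> ('a set \<Rightarrow> nat) \<Rightarrow> 'a list \<Rightarrow> bool" where
  "total_proper_path cv ce p \<longleftrightarrow>
    (\<forall>i. i + 2 < length p \<longrightarrow> ce {p ! i, p ! (i + 1)} \<noteq> ce {p ! (i + 1), p ! (i + 2)}) \<and>
    (\<forall>i. 0 < i \<and> i + 2 < length p \<longrightarrow> cv (p ! i) \<noteq> cv (p ! (i + 1))) \<and>
    (\<forall>i. 0 < i \<and> i + 1 < length p \<longrightarrow>
      cv (p ! i) \<noteq> ce {p ! (i - 1), p ! i} \<and> cv (p ! i) \<noteq> ce {p ! i, p ! (i + 1)})"

definition total_proper_connected ::
  "'a pair_pre_digraph \<Rightarrow> ('a \<Rightarrow> nat) \<Rightarrow> ('a set \<Rightarrow> nat) \<Rightarrow> bool" where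
  "total_proper_connected G cv ce \<longleftrightarrow>
    (\<forall>u \<in> pverts G. \<forall>v \<in> pverts G.
      \<exists>p. vpath p G \<and> hd p = u \<and> last p = v \<and> total_proper_path cv ce p)"

definition tpc :: "'a pair_pre_digraph \<Rightarrow> nat" where
  "tpc G = (LEAST k. \<exists>cv ce. total_proper_connected G cv ce \<and>
    card (cv ` pverts G \<union> ce ` uedges G) = k)"

text \<open>The minimum in \<^const>\<open>tpc\<close> exists: give all vertices and edges distinct colours.\<close>

lemma nth_vwalk_arcs:
  "i + 1 < length p \<Longrightarrow> (p ! i, p ! (i + 1)) \<in> set (vwalk_arcs p)"
proof (induction p arbitrary: i rule: vwalk_arcs.induct)
  case (3 x y xs)
  then show ?case by (cases i) auto
qed auto

lemma ex_total_proper_connected: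
  assumes G: "pair_graph G" and conn: "connected G"
  shows "\<exists>cv ce. total_proper_connected G cv ce"
proof -
  interpret pair_graph G by (rule G)
  have "finite (Inl ` pverts G \<union> Inr ` uedges G :: ('a + 'a set) set)"
  proof -
    have "uedges G = (\<lambda>(u, v). {u, v}) ` parcs G" by (auto simp: uedges_def)
    then show ?thesis using pair_finite_verts pair_finite_arcs by simp
  qed
  from finite_imp_inj_to_nat_seg[OF this] obtain f :: "'a + 'a set \<Rightarrow> nat"
    where f: "inj_on f (Inl ` pverts G \<union> Inr ` uedges G)"
    by blast
  have "total_proper_connected G (f \<circ> Inl) (f \<circ> Inr)"
    unfolding total_proper_connected_def
  proof (intro ballI)
    fix u v assume uv: "u \<in> pverts G" "v \<in> pverts G"
    have "u \<rightarrow>\<^sup>*\<^bsub>with_proj (mk_symmetric G)\<^esub> v"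
      using conn uv by (auto simp: connected_def strongly_connected_def)
    then have "u \<rightarrow>\<^sup>*\<^bsub>with_proj G\<^esub> v"
      using reachable_mk_symmetric_eq[OF pair_sym_arcs] by simp
    then obtain p where p: "vpath p G" "hd p = u" "last p = v"
      using reachable_vpath_conv[of u v] by auto
    have dist: "distinct p" and sub: "set p \<subseteq> pverts G"
      using p(1) by (auto simp: vpath_def vwalk_def)
    have edge: "{p ! i, p ! (i + 1)} \<in> uedges G" if "i + 1 < length p" for i
      using nth_vwalk_arcs[OF that] p(1) by (auto simp: vpath_def vwalk_def uedges_def)
    have vert: "p ! i \<in> pverts G" if "i < length p" for i
      using that sub by auto
    have "total_proper_path (f \<circ> Inl) (f \<circ> Inr) p"
      unfolding total_proper_path_def o_def
    proof (intro conjI allI impI)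
      fix i assume i: "i + 2 < length p"
      have "{p ! i, p ! (i + 1)} \<noteq> {p ! (i + 1), p ! (i + 2)}"
        using dist i by (auto simp: doubleton_eq_iff nth_eq_iff_index_eq)
      moreover have "{p ! (i + 1), p ! (i + 2)} \<in> uedges G" using edge[of "i + 1"] i by simp
      ultimately show "f (Inr {p ! i, p ! (i + 1)}) \<noteq> f (Inr {p ! (i + 1), p ! (i + 2)})"
        using inj_onD[OF f, of "Inr {p ! i, p ! (i + 1)}" "Inr {p ! (i + 1), p ! (i + 2)}"]
          edge[of i] i by auto
    next
      fix i assume i: "0 < i \<and> i + 2 < length p"
      then have "p ! i \<noteq> p ! (i + 1)" using dist by (simp add: nth_eq_iff_index_eq)
      then show "f (Inl (p ! i)) \<noteq> f (Inl (p ! (i + 1)))"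
        using inj_onD[OF f, of "Inl (p ! i)" "Inl (p ! (i + 1))"] vert[of i] vert[of "i + 1"] i
        by auto
    next
      fix i assume i: "0 < i \<and> i + 1 < length p"
      then show "f (Inl (p ! i)) \<noteq> f (Inr {p ! (i - 1), p ! i})"
        using inj_onD[OF f, of "Inl (p ! i)" "Inr {p ! (i - 1), p ! i}"] vert[of i]
          edge[of "i - 1"] by auto
      show "f (Inl (p ! i)) \<noteq> f (Inr {p ! i, p ! (i + 1)})"
        using inj_onD[OF f, of "Inl (p ! i)" "Inr {p ! i, p ! (i + 1)}"] vert[of i]
          edge[of i] i by auto
    qed
    with p show "\<exists>p. vpath p G \<and> hd p = u \<and> last p = v \<and> total_proper_path (f \<circ> Inl) (f \<circ> Inr) p"
      by blast
  qed
  then show ?thesis by blast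
qed

end

theory Submission
  imports Defs
begin

text \<open>
  Label the vertices by residues modulo 3 and colour every edge with the third colour, different from
  the labels of its ends. A path along which the label increases by 1 modulo 3 at every step is
  then total proper, in both directions. So it suffices to find a labelling for which the digraph of
  the arcs that increase the label by 1 is unilateral: of any two vertices one reaches the other.
  Since reachability by walks and by paths agree, no path has to be written down.

  Let \<open>v\<close> have maximum degree in \<open>H\<close>, let \<open>w\<close> be its only non-neighbour and \<open>u\<close> a common neighbour
  of \<open>v\<close> and \<open>w\<close>; let the layers be numbered along a Hamiltonian path of \<open>G\<close>. In two consecutive
  layers, \<open>v\<close>, \<open>u\<close> and any other neighbour \<open>x\<close> of \<open>v\<close> span a 6-cycle which is labelled
  \<open>0,1,2,0,1,2\<close>, in alternating directions, so that these cycles together make everything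
  outside the column of \<open>w\<close> strongly connected. The column of \<open>w\<close> is one directed path entering this part.
\<close>

section \<open>Labellings modulo 3\<close>

definition label_arcs :: "'a pair_pre_digraph \<Rightarrow> ('a \<Rightarrow> nat) \<Rightarrow> ('a \<times> 'a) set" where
  "label_arcs K f = {(y, z) \<in> parcs K. f z = (f y + 1) mod 3}"

text \<open>On an edge \<open>{y, z}\<close> whose ends have distinct labels below 3, this is the third residue.\<close>

definition third_colour :: "('a \<Rightarrow> nat) \<Rightarrow> 'a set \<Rightarrow> nat" where
  "third_colour f e = 2 * (\<Sum>y\<in>e. f y) mod 3"

text \<open>The residues 0, 1, 2 sum to 0 modulo 3, so the one missing from
  \<open>{f y, f z}\<close> is \<open>- (f y + f z)\<close>, that is, twice the sum. Distinct labels
  force \<open>y\<close> and \<open>z\<close> to differ, so the sum over the set counts both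
  ends.\<close>

lemma third_colour_doubleton:
  assumes "f y \<noteq> f z"
  shows "third_colour f {y, z} = 2 * (f y + f z) mod 3"
  using assms by (cases "y = z") (simp_all add: third_colour_def)

text \<open>Modulo 3, consecutive labels \<open>a\<close>, \<open>a + d\<close>,
  \<open>a + 2 * d\<close> are all different. The edge between the first two gets
  \<open>a + 2 * d\<close>, the next edge gets \<open>a\<close>, and the vertex between them has
  \<open>a + d\<close>. Taking \<open>d = 2\<close> covers paths run backwards.\<close>

lemma total_proper_path_label:
  assumes lt: "\<And>y. f y < 3" and d: "d = 1 \<or> d = 2"
    and step: "successively (\<lambda>y z. f z = (f y + d) mod 3) p"
  shows "total_proper_path f (third_colour f) p"
proof -
  have s: "f (p ! Suc i) = (f (p ! i) + d) mod 3" if "Suc i < length p" for i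
    using step that by (simp add: successively_conv_nth)
  have r: "f y \<in> {0, 1, 2}" for y using lt[of y] by auto
  have ne: "f (p ! i) \<noteq> f (p ! Suc i)" if "Suc i < length p" for i
    using s[OF that] r[of "p ! i"] d by auto
  have e: "third_colour f {p ! i, p ! Suc i} = 2 * (f (p ! i) + (f (p ! i) + d) mod 3) mod 3"
    if "Suc i < length p" for i
    using third_colour_doubleton[of f "p ! i" "p ! Suc i"] ne[OF that] s[OF that] by simp
  have edges: "third_colour f {p ! i, p ! Suc i} \<noteq> third_colour f {p ! Suc i, p ! Suc (Suc i)}"
    if "Suc (Suc i) < length p" for i
    using e[of i] e[of "Suc i"] s[of i] that r[of "p ! i"] d by auto
  have left: "f (p ! i) \<noteq> third_colour f {p ! i, p ! Suc i}" if "Suc i < length p" for i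
    using e[of i] that r[of "p ! i"] d by auto
  have right: "f (p ! Suc i) \<noteq> third_colour f {p ! i, p ! Suc i}" if "Suc i < length p" for i
    using e[of i] s[of i] that r[of "p ! i"] d by auto
  show ?thesis
    unfolding total_proper_path_def
  proof (intro conjI allI impI)
    fix i assume "0 < i \<and> i + 1 < length p"
    then show "f (p ! i) \<noteq> third_colour f {p ! (i - 1), p ! i}"
      using right[of "i - 1"] by simp
  qed (use edges ne left in auto)
qed

lemma rtrancl_imp_distinct_list:
  assumes "(y, z) \<in> R\<^sup>*"
  shows "\<exists>q. q \<noteq> [] \<and> distinct q \<and> hd q = y \<and> last q = z \<and> successively (\<lambda>a b. (a, b) \<in> R) q"
  using assms
proof (induction rule: rtrancl_induct)
  case base
  show ?case by (rule exI[of _ "[y]"]) simp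
next
  case (step b c)
  then obtain q where q: "q \<noteq> []" "distinct q" "hd q = y" "last q = b"
    "successively (\<lambda>a b. (a, b) \<in> R) q" by blast
  show ?case
  proof (cases "c \<in> set q")
    case True
    \<comment> \<open>A walk returning to \<open>c\<close> is cut off at the occurrence of
      \<open>c\<close> already in \<open>q\<close>.\<close>
    then obtain xs ys where "q = xs @ c # ys" by (meson split_list)
    then have "q = (xs @ [c]) @ ys" by simp
    then show ?thesis using q
      by (intro exI[of _ "xs @ [c]"]) (auto simp: successively_append_iff hd_append)
  next
    case False
    then show ?thesis using q step.hyps
      by (intro exI[of _ "q @ [c]"]) (auto simp: successively_append_iff)
  qed
qed

lemma vwalk_with_proj_iff:
  "vwalk p (with_proj K) \<longleftrightarrow>
    p \<noteq> [] \<and> set p \<subseteq> pverts K \<and> successively (\<lambda>a b. (a, b) \<in> parcs K) p"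
  unfolding vwalk_def by (induction p rule: vwalk_arcs.induct) auto

text \<open>Reachability in one direction suffices: a path raising the label by 1 is, when reversed,
  a path raising it by 2, and both are total proper.\<close>

lemma total_proper_connected_label:
  assumes K: "pair_graph K" and lt: "\<And>y. f y < 3"
    and unilateral: "\<And>y z. y \<in> pverts K \<Longrightarrow> z \<in> pverts K \<Longrightarrow>
      (y, z) \<in> (label_arcs K f)\<^sup>* \<or> (z, y) \<in> (label_arcs K f)\<^sup>*"
  shows "total_proper_connected K f (third_colour f)"
proof -
  interpret pair_graph K by (rule K)
  have sym: "(b, a) \<in> parcs K" if "(a, b) \<in> parcs K" for a b
    using pair_sym_arcs that by (auto simp: symmetric_def elim: symE)
  have ex: "\<exists>q. vpath q (with_proj K) \<and> hd q = y \<and> last q = z \<and> vpath (rev q) (with_proj K) \<and>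
      total_proper_path f (third_colour f) q \<and> total_proper_path f (third_colour f) (rev q)"
    if reach: "(y, z) \<in> (label_arcs K f)\<^sup>*" and y: "y \<in> pverts K" for y z
  proof -
    obtain q where q: "q \<noteq> []" "distinct q" "hd q = y" "last q = z"
      and suc: "successively (\<lambda>a b. (a, b) \<in> label_arcs K f) q"
      using rtrancl_imp_distinct_list[OF reach] by blast
    have arcs: "successively (\<lambda>a b. (a, b) \<in> parcs K) q"
      using suc by (rule successively_mono) (auto simp: label_arcs_def)
    have up: "successively (\<lambda>a b. f b = (f a + 1) mod 3) q"
      using suc by (rule successively_mono) (auto simp: label_arcs_def)
    have arcs': "successively (\<lambda>a b. (a, b) \<in> parcs K) (rev q)"
      unfolding successively_rev using arcs by (rule successively_mono) (rule sym)
    have down: "successively (\<lambda>a b. f b = (f a + 2) mod 3) (rev q)"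
      unfolding successively_rev using up
    proof (rule successively_mono)
      fix a b assume "f b = (f a + 1) mod 3"
      moreover have "f a \<in> {0, 1, 2}" using lt[of a] by auto
      ultimately show "f a = (f b + 2) mod 3" by auto
    qed
    \<comment> \<open>Every later vertex is the head of an arc; the first one needs
      \<open>y \<in> pverts K\<close>, since a one-vertex path has no arcs.\<close>
    have sub: "set q \<subseteq> pverts K"
    proof
      fix b assume "b \<in> set q"
      then obtain i where i: "i < length q" "b = q ! i" by (auto simp: in_set_conv_nth)
      show "b \<in> pverts K"
      proof (cases i)
        case 0
        then show ?thesis using i q y by (simp add: hd_conv_nth)
      next
        case (Suc j)
        then have "(q ! j, b) \<in> parcs K" using arcs i by (simp add: successively_conv_nth)
        then show ?thesis using arc_snd_in_verts by fastforce
      qed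
    qed
    show ?thesis
      using q sub arcs arcs' total_proper_path_label[OF lt _ up] total_proper_path_label[OF lt _ down]
      by (intro exI[of _ q]) (auto simp: vpath_def vwalk_with_proj_iff)
  qed
  show ?thesis
    unfolding total_proper_connected_def
  proof (intro ballI)
    fix y z assume yz: "y \<in> pverts K" "z \<in> pverts K"
    show "\<exists>q. vpath q (with_proj K) \<and> hd q = y \<and> last q = z \<and> total_proper_path f (third_colour f) q"
      using unilateral[OF yz]
    proof
      assume "(y, z) \<in> (label_arcs K f)\<^sup>*"
      from ex[OF this yz(1)] show ?thesis by blast
    next
      assume "(z, y) \<in> (label_arcs K f)\<^sup>*"
      from ex[OF this yz(2)] obtain q where q: "vpath (rev q) (with_proj K)" "hd q = z" "last q = y"
        "total_proper_path f (third_colour f) (rev q)" by blast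
      then have "q \<noteq> []" by (auto simp: vpath_def vwalk_def)
      with q show ?thesis by (intro exI[of _ "rev q"]) (auto simp: hd_rev last_rev)
    qed
  qed
qed

section \<open>The labelling of the product\<close>

text \<open>Column \<open>v\<close> is constant, while \<open>u\<close> and the remaining vertices
  alternate between 0 and 1 in opposite phase. In column \<open>w\<close> the label is
  \<open>-i\<close> modulo 3, so its arcs run towards layer 0.\<close>

definition layer_label :: "'b \<Rightarrow> 'b \<Rightarrow> 'b \<Rightarrow> nat \<Rightarrow> 'b \<Rightarrow> nat" where
  "layer_label v u w i h =
    (if h = w then 2 * i mod 3 else if h = v then 2 else if h = u then (i + 1) mod 2 else i mod 2)"

lemma layer_label_less: "layer_label v u w i h < 3"
  by (auto simp: layer_label_def intro: less_trans[OF mod_less_divisor])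

lemma directed_six_cycle_connected:
  assumes "(a, b) \<in> R" "(b, c) \<in> R" "(c, d) \<in> R" "(d, e) \<in> R" "(e, f) \<in> R" "(f, a) \<in> R"
  shows "\<forall>z \<in> {a, b, c, d, e, f}. (a, z) \<in> R\<^sup>* \<and> (z, a) \<in> R\<^sup>*"
proof -
  have "(a, b) \<in> R\<^sup>*" using assms(1) by blast
  moreover from this have "(a, c) \<in> R\<^sup>*" using assms(2) by (rule rtrancl_into_rtrancl)
  moreover from this have "(a, d) \<in> R\<^sup>*" using assms(3) by (rule rtrancl_into_rtrancl)
  moreover from this have "(a, e) \<in> R\<^sup>*" using assms(4) by (rule rtrancl_into_rtrancl)
  moreover from this have "(a, f) \<in> R\<^sup>*" using assms(5) by (rule rtrancl_into_rtrancl)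
  moreover have "(f, a) \<in> R\<^sup>*" using assms(6) by blast
  moreover from assms(5) this have "(e, a) \<in> R\<^sup>*" by (rule converse_rtrancl_into_rtrancl)
  moreover from assms(4) this have "(d, a) \<in> R\<^sup>*" by (rule converse_rtrancl_into_rtrancl)
  moreover from assms(3) this have "(c, a) \<in> R\<^sup>*" by (rule converse_rtrancl_into_rtrancl)
  moreover from assms(2) this have "(b, a) \<in> R\<^sup>*" by (rule converse_rtrancl_into_rtrancl)
  ultimately show ?thesis by simp
qed

text \<open>The argument is kept free of the product graph: \<open>c i h\<close> stands for the copy
  of \<open>h\<close> in layer \<open>i\<close>, and all that is asked of \<open>R\<close> is that
  it contains the label-raising arcs inside a layer and between consecutive layers.\<close>

lemma grid_unilateral:
  fixes c :: "nat \<Rightarrow> 'b \<Rightarrow> 'c" and n :: nat and v u w x :: 'b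
  defines "l \<equiv> layer_label v u w"
  assumes n: "n \<ge> 2"
    and inV: "v \<in> V" "u \<in> V" "w \<in> V" "x \<in> V"
    and dist: "v \<noteq> u" "v \<noteq> w" "u \<noteq> w" "x \<notin> {v, u, w}"
    and nb: "\<And>h. h \<in> V - {v, w} \<Longrightarrow> (v, h) \<in> E \<and> (h, v) \<in> E" and wu: "(w, u) \<in> E"
    and hor: "\<And>i h h'. i < n \<Longrightarrow> (h, h') \<in> E \<Longrightarrow> l i h' = (l i h + 1) mod 3 \<Longrightarrow> (c i h, c i h') \<in> R"
    and ver: "\<And>i h. Suc i < n \<Longrightarrow> h \<in> V \<Longrightarrow> l (Suc i) h = (l i h + 1) mod 3 \<Longrightarrow> (c i h, c (Suc i) h) \<in> R"
    and ver': "\<And>i h. Suc i < n \<Longrightarrow> h \<in> V \<Longrightarrow> l i h = (l (Suc i) h + 1) mod 3 \<Longrightarrow> (c (Suc i) h, c i h) \<in> R"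
    and ij: "i < n" "j < n" and hk: "h \<in> V" "k \<in> V"
  shows "(c i h, c j k) \<in> R\<^sup>* \<or> (c j k, c i h) \<in> R\<^sup>*"
proof -
  have E: "(u, v) \<in> E" "(v, u) \<in> E" using nb[of u] inV dist by auto
  have cycle: "(c i v, c j z) \<in> R\<^sup>* \<and> (c j z, c i v) \<in> R\<^sup>*"
    if i: "Suc i < n" and y: "y \<in> V - {v, u, w}" and jz: "j = i \<or> j = Suc i" "z \<in> {v, u, y}" for i j y z
  proof -
    have yE: "(v, y) \<in> E" "(y, v) \<in> E" using nb[of y] y by auto
    have even: "l k u = 1" "l k y = 0" if "even k" for k
      using that y dist by (auto simp: l_def layer_label_def even_iff_mod_2_eq_zero mod_Suc)
    have odd: "l k u = 0" "l k y = 1" if "odd k" for k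
      using that y dist by (auto simp: l_def layer_label_def odd_iff_mod_2_eq_one mod_Suc)
    have lv: "l k v = 2" for k using dist by (simp add: l_def layer_label_def)
    show ?thesis
    \<comment> \<open>The parity of \<open>i\<close> decides the direction of the 6-cycle: from
      \<open>v\<close> in layer \<open>i\<close> it first visits \<open>y\<close> if
      \<open>i\<close> is even, and \<open>u\<close> if \<open>i\<close> is odd.\<close>
    proof (cases "even i")
      case True
      have "(c i v, c i y) \<in> R" "(c i u, c i v) \<in> R"
        "(c (Suc i) y, c (Suc i) v) \<in> R" "(c (Suc i) v, c (Suc i) u) \<in> R"
        using i True yE E by (auto intro!: hor simp: even odd lv)
      moreover have "(c i y, c (Suc i) y) \<in> R" "(c (Suc i) u, c i u) \<in> R"
        using i True y inV by (auto intro!: ver ver' simp: even odd)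
      ultimately have "\<forall>z' \<in> {c i v, c i y, c (Suc i) y, c (Suc i) v, c (Suc i) u, c i u}.
          (c i v, z') \<in> R\<^sup>* \<and> (z', c i v) \<in> R\<^sup>*"
        by (intro directed_six_cycle_connected)
      then show ?thesis using jz by auto
    next
      case False
      have "(c i y, c i v) \<in> R" "(c i v, c i u) \<in> R"
        "(c (Suc i) v, c (Suc i) y) \<in> R" "(c (Suc i) u, c (Suc i) v) \<in> R"
        using i False yE E by (auto intro!: hor simp: even odd lv)
      moreover have "(c i u, c (Suc i) u) \<in> R" "(c (Suc i) y, c i y) \<in> R"
        using i False y inV by (auto intro!: ver ver' simp: even odd)
      ultimately have "\<forall>z' \<in> {c i v, c i u, c (Suc i) u, c (Suc i) v, c (Suc i) y, c i y}.
          (c i v, z') \<in> R\<^sup>* \<and> (z', c i v) \<in> R\<^sup>*"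
        by (intro directed_six_cycle_connected)
      then show ?thesis using jz by auto
    qed
  qed
  have column_v: "(c 0 v, c i v) \<in> R\<^sup>* \<and> (c i v, c 0 v) \<in> R\<^sup>*" if "i < n" for i
    using that
  proof (induction i)
    case (Suc i)
    then show ?case using cycle[of i x "Suc i" v] inV dist by (auto intro: rtrancl_trans)
  qed simp
  have layer: "(c i v, c i h) \<in> R\<^sup>* \<and> (c i h, c i v) \<in> R\<^sup>*" if i: "i < n" and h: "h \<in> V - {w}" for i h
  proof -
    \<comment> \<open>A 6-cycle needs a third column besides \<open>v\<close> and \<open>u\<close>;
      \<open>x\<close> fills this place when \<open>h\<close> is \<open>u\<close> or
      \<open>v\<close> itself.\<close>
    define y where "y = (if h \<in> {u, v} then x else h)"
    have y: "y \<in> V - {v, u, w}" and hy: "h = v \<or> h = u \<or> h = y"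
      using h inV dist by (auto simp: y_def)
    show ?thesis
    \<comment> \<open>Layer 0 is paired with layer 1, which exists because \<open>n \<ge> 2\<close>;
      any other layer is paired with the preceding one.\<close>
    proof (cases i)
      case 0
      then have "Suc i < n" using n by simp
      with 0 hy cycle[OF this y, of 0 h] show ?thesis by auto
    next
      case (Suc k)
      with hy i cycle[of k y i h] cycle[of k y i v] y show ?thesis by (auto intro: rtrancl_trans)
    qed
  qed
  have core: "(c 0 v, c i h) \<in> R\<^sup>* \<and> (c i h, c 0 v) \<in> R\<^sup>*" if "i < n" "h \<in> V - {w}" for i h
    using column_v[OF that(1)] layer[OF that] by (auto intro: rtrancl_trans)
  have column_w: "(c (i + d) w, c i w) \<in> R\<^sup>*" if "i + d < n" for i d
    using that
  proof (induction d)
    case (Suc d)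
    \<comment> \<open>Modulo 3, \<open>2 * (m + 1) + 1 = 2 * m\<close>, so the label rises on going
      one layer back.\<close>
    have "2 * (i + d) mod 3 = (2 * Suc (i + d) mod 3 + 1) mod 3" by presburger
    then have "(c (Suc (i + d)) w, c (i + d) w) \<in> R"
      using Suc.prems inV by (auto intro!: ver' simp: l_def layer_label_def)
    then show ?case using Suc by (auto intro: converse_rtrancl_into_rtrancl)
  qed simp
  have tail: "(c i w, c 0 v) \<in> R\<^sup>*" if "i < n" for i
  proof -
    \<comment> \<open>In layer 0 the labels of \<open>w\<close> and \<open>u\<close> are 0 and 1:
      this arc leads out of column \<open>w\<close>.\<close>
    have "(c 0 w, c 0 u) \<in> R" using n wu dist by (auto intro!: hor simp: l_def layer_label_def)
    moreover have "(c 0 u, c 0 v) \<in> R\<^sup>*" using core[of 0 u] n inV dist by auto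
    ultimately show ?thesis using column_w[of 0 i] that by auto
  qed
  show ?thesis
  proof (cases "h = w \<and> k = w")
    \<comment> \<open>Within column \<open>w\<close> the copy in the higher layer reaches the other
      one.\<close>
    case True
    then show ?thesis using column_w[of i "j - i"] column_w[of j "i - j"] ij by (cases "i \<le> j") auto
  next
    case False
    then show ?thesis
      using core[of i h] core[of j k] tail[of i] tail[of j] ij hk
      by (cases "h = w"; cases "k = w") (auto intro: rtrancl_trans)
  qed
qed

section \<open>The Cartesian product\<close>

lemma pair_graph_arc_sym:
  assumes "pair_graph G" "(a, b) \<in> parcs G"
  shows "(b, a) \<in> parcs G"
  using pair_sym_digraph.pair_sym_arcs[of G] assms
  by (auto simp: symmetric_def pair_graph_def pair_pseudo_graph_def elim: symE)

lemma pair_graph_cart_prod: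
  assumes G: "pair_graph G" and H: "pair_graph H"
  shows "pair_graph (cart_prod G H)"
proof -
  interpret G: pair_graph G by (rule G)
  interpret H: pair_graph H by (rule H)
  have fin: "finite (pverts G \<times> pverts H)" using G.pair_finite_verts H.pair_finite_verts by simp
  show ?thesis
  proof
    show "finite (parcs (cart_prod G H))"
      by (rule finite_subset[of _ "(pverts G \<times> pverts H) \<times> (pverts G \<times> pverts H)"])
        (use fin in \<open>auto simp: cart_prod_def\<close>)
    show "symmetric (with_proj (cart_prod G H))"
      using pair_graph_arc_sym[OF G] pair_graph_arc_sym[OF H]
      by (auto simp: symmetric_def cart_prod_def intro!: symI)
  qed (use fin G.pair_no_loops H.pair_no_loops in \<open>auto simp: cart_prod_def\<close>)
qed

text \<open>A path between distinct non-adjacent vertices has at least two edges, and an internal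
  vertex together with its two path edges already shows three colours.\<close>

lemma three_colours_needed:
  assumes K: "pair_graph K" and con: "total_proper_connected K cv ce"
    and y: "y \<in> pverts K" and z: "z \<in> pverts K" and yz: "y \<noteq> z" "(y, z) \<notin> parcs K"
  shows "3 \<le> card (cv ` pverts K \<union> ce ` uedges K)"
proof -
  interpret pair_graph K by (rule K)
  obtain p where p: "vpath p (with_proj K)" "hd p = y" "last p = z" and tp: "total_proper_path cv ce p"
    using con y z unfolding total_proper_connected_def by blast
  have "p \<noteq> []" "p \<noteq> [a]" "p \<noteq> [a, b]" for a b
    using p yz by (auto simp: vpath_def vwalk_def)
  then obtain a b d q where p_eq: "p = a # b # d # q" by (metis neq_Nil_conv)
  have "b \<in> pverts K" "{a, b} \<in> uedges K" "{b, d} \<in> uedges K"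
    using p(1) p_eq by (auto simp: vpath_def vwalk_def uedges_def)
  then have sub: "{cv b, ce {a, b}, ce {b, d}} \<subseteq> cv ` pverts K \<union> ce ` uedges K" by blast
  have "ce {a, b} \<noteq> ce {b, d}" "cv b \<noteq> ce {a, b}" "cv b \<noteq> ce {b, d}"
  proof -
    have "0 + 2 < length p" "0 < (1 :: nat) \<and> 1 + 1 < length p" using p_eq by simp_all
    then have "ce {p ! 0, p ! (0 + 1)} \<noteq> ce {p ! (0 + 1), p ! (0 + 2)}"
      "cv (p ! 1) \<noteq> ce {p ! (1 - 1), p ! 1} \<and> cv (p ! 1) \<noteq> ce {p ! 1, p ! (1 + 1)}"
      using tp unfolding total_proper_path_def by blast+
    then show "ce {a, b} \<noteq> ce {b, d}" "cv b \<noteq> ce {a, b}" "cv b \<noteq> ce {b, d}"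
      using p_eq by simp_all
  qed
  then have "card {cv b, ce {a, b}, ce {b, d}} = 3" by auto
  moreover have "uedges K = (\<lambda>(a, b). {a, b}) ` parcs K" by (auto simp: uedges_def)
  then have "finite (cv ` pverts K \<union> ce ` uedges K)" using pair_finite_verts pair_finite_arcs by simp
  ultimately show ?thesis using card_mono[OF _ sub] by simp
qed

lemma spanning_broom:
  assumes H: "pair_graph H" and con: "connected (with_proj H)" and deg: "max_degree H + 2 = card (pverts H)"
  obtains v u w x where "v \<in> pverts H" "u \<in> pverts H" "w \<in> pverts H" "x \<in> pverts H"
    "v \<noteq> u" "v \<noteq> w" "u \<noteq> w" "x \<notin> {v, u, w}" "(w, u) \<in> parcs H" "(v, w) \<notin> parcs H"
    "\<And>h. h \<in> pverts H - {v, w} \<Longrightarrow> (v, h) \<in> parcs H"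
proof -
  interpret pair_graph H by (rule H)
  define N where "N h = {h'. (h, h') \<in> parcs H}" for h
  have od: "out_degree H h = card (N h)" for h
  proof -
    have "out_arcs H h = Pair h ` N h" by (auto simp: out_arcs_def N_def)
    then show ?thesis by (simp add: out_degree_def card_image inj_on_def)
  qed
  have NV: "N h \<subseteq> pverts H" and hN: "h \<notin> N h" for h
    using arc_snd_in_verts[of "(h, _)"] pair_no_loops[of "(h, h)"] by (auto simp: N_def)
  have fin: "finite (pverts H)" "finite (N h)" for h
    using pair_finite_verts finite_subset[OF NV] by auto
  have ne: "pverts H \<noteq> {}" using deg by auto
  have "Max (out_degree H ` pverts H) \<in> out_degree H ` pverts H" using fin ne by (intro Max_in) auto
  then obtain v where v: "v \<in> pverts H" "card (N v) = max_degree H"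
    by (auto simp: max_degree_def od)
  have max: "card (N h) \<le> card (N v)" if "h \<in> pverts H" for h
  proof -
    have "out_degree H h \<le> max_degree H"
      unfolding max_degree_def using that fin by (intro Max_ge) auto
    then show ?thesis using od v(2) by simp
  qed
  \<comment> \<open>The vertex \<open>v\<close> and its neighbours number
    \<open>max_degree H + 1\<close>, one less than all vertices.\<close>
  have "card (pverts H - insert v (N v)) = 1"
    using card_Diff_subset[of "insert v (N v)" "pverts H"] fin hN NV v deg by simp
  then obtain w where w: "pverts H - insert v (N v) = {w}" by (auto simp: card_1_singleton_iff)
  then have "w \<in> pverts H - insert v (N v)" by simp
  then have wV: "w \<in> pverts H" "w \<noteq> v" "w \<notin> N v" by simp_all
  have nb: "h \<in> N v" if "h \<in> pverts H - {v, w}" for h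
  proof (rule ccontr)
    assume "h \<notin> N v"
    then have "h \<in> pverts H - insert v (N v)" using that by simp
    then show False using that unfolding w by simp
  qed
  have "v \<rightarrow>\<^sup>*\<^bsub>with_proj (mk_symmetric H)\<^esub> w"
    using con v wV by (auto simp: connected_def strongly_connected_def)
  then have "v \<rightarrow>\<^sup>*\<^bsub>with_proj H\<^esub> w" using reachable_mk_symmetric_eq[OF pair_sym_arcs] by simp
  \<comment> \<open>As \<open>w \<noteq> v\<close>, a walk from \<open>v\<close> to \<open>w\<close>
    has a last arc, which supplies \<open>u\<close>.\<close>
  then have "\<exists>u. (u, w) \<in> parcs H"
    using wV(2) by (induction rule: reachable_induct) auto
  then obtain u where u: "(u, w) \<in> parcs H" by blast
  then have uV: "u \<in> pverts H" "u \<noteq> w" using arc_fst_in_verts[OF u] pair_no_loops[OF u] by auto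
  have uv: "u \<noteq> v" using u wV by (auto simp: N_def)
  then have uN: "u \<in> N v" using nb uV by simp
  \<comment> \<open>If \<open>u\<close> were the only neighbour of \<open>v\<close>, the maximum
    degree would be 1, yet \<open>u\<close> is adjacent to both \<open>v\<close> and
    \<open>w\<close>.\<close>
  have "\<exists>x. x \<in> N v - {u}"
  proof (rule ccontr)
    assume "\<not> (\<exists>x. x \<in> N v - {u})"
    then have "N v = {u}" using uN by blast
    then have "card (N u) \<le> 1" using max[OF uV(1)] by simp
    moreover have "{v, w} \<subseteq> N u" using u uN pair_graph_arc_sym[OF H] by (auto simp: N_def)
    then have "card {v, w} \<le> card (N u)" using fin by (intro card_mono) auto
    ultimately show False using wV by simp
  qed
  then obtain x where x: "x \<in> N v" "x \<noteq> u" by blast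
  show thesis
  proof (rule that[of v u w x])
    show "(v, h) \<in> parcs H" if "h \<in> pverts H - {v, w}" for h
      using nb[OF that] by (simp add: N_def)
    show "x \<notin> {v, u, w}" using x wV hN by auto
    show "x \<in> pverts H" using x NV by auto
  qed (use v u uV uv wV pair_graph_arc_sym[OF H u] in \<open>auto simp: N_def\<close>)
qed

theorem theorem3p3:
  fixes G :: "'a pair_pre_digraph" and H :: "'b pair_pre_digraph"
  assumes "pair_graph G" and "card (pverts G) \<ge> 2" and "traceable G"
    and "pair_graph H" and "connected H" and "max_degree H + 2 = card (pverts H)"
  shows "tpc (cart_prod G H) = 3"
proof -
  interpret H: pair_graph H by (rule assms(4))
  obtain v u w x where inV: "v \<in> pverts H" "u \<in> pverts H" "w \<in> pverts H" "x \<in> pverts H"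
    and dist: "v \<noteq> u" "v \<noteq> w" "u \<noteq> w" "x \<notin> {v, u, w}"
    and wu: "(w, u) \<in> parcs H" and vw: "(v, w) \<notin> parcs H"
    and nb: "\<And>h. h \<in> pverts H - {v, w} \<Longrightarrow> (v, h) \<in> parcs H"
    using spanning_broom[OF assms(4-6)] by metis
  obtain p where p: "distinct p" "set p = pverts G" "successively (\<lambda>a b. (a, b) \<in> parcs G) p"
    using assms(3) by (auto simp: traceable_def vpath_def vwalk_with_proj_iff)
  define n where "n = length p"
  have n: "n \<ge> 2" using assms(2) distinct_card[OF p(1)] p(2) by (simp add: n_def)
  have pV: "p ! i \<in> pverts G" if "i < n" for i
    using nth_mem[of i p] that p(2) by (simp add: n_def)
  have pE: "(p ! i, p ! Suc i) \<in> parcs G" "(p ! Suc i, p ! i) \<in> parcs G" if "Suc i < n" for i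
    using p(3) that pair_graph_arc_sym[OF assms(1)] unfolding n_def successively_conv_nth by blast+
  define K where "K = cart_prod G H"
  have K: "pair_graph K" unfolding K_def by (rule pair_graph_cart_prod[OF assms(1,4)])
  have KV: "pverts K = pverts G \<times> pverts H" by (simp add: K_def cart_prod_def)
  \<comment> \<open>The label has to be a function of the vertex, so the layer number is recovered
    as the position on the Hamiltonian path.\<close>
  define idx where "idx = inv_into {..<n} ((!) p)"
  have idx: "idx (p ! i) = i" if "i < n" for i
    unfolding idx_def using that p(1) by (intro inv_into_f_f) (auto simp: inj_on_def n_def nth_eq_iff_index_eq)
  define f where "f = (\<lambda>(g, h). layer_label v u w (idx g) h)"
  have lt: "f y < 3" for y by (auto simp: f_def layer_label_less split: prod.split)
  have HE: "a \<in> pverts H" "b \<in> pverts H" if "(a, b) \<in> parcs H" for a b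
    using H.arc_fst_in_verts[OF that] H.arc_snd_in_verts[OF that] by simp_all
  have fi: "f (p ! i, h) = layer_label v u w i h" if "i < n" for i h
    using idx[OF that] by (simp add: f_def)
  have nb': "(v, h) \<in> parcs H \<and> (h, v) \<in> parcs H" if "h \<in> pverts H - {v, w}" for h
    using nb[OF that] pair_graph_arc_sym[OF assms(4)] by blast
  have hor: "((p ! i, h), (p ! i, h')) \<in> label_arcs K f"
    if "i < n" "(h, h') \<in> parcs H" "layer_label v u w i h' = (layer_label v u w i h + 1) mod 3" for i h h'
    using that(1,3) pV[OF that(1)] HE[OF that(2)] that(2)
    by (simp add: label_arcs_def K_def cart_prod_def fi)
  have ver: "((p ! i, h), (p ! Suc i, h)) \<in> label_arcs K f"
    if "Suc i < n" "h \<in> pverts H" "layer_label v u w (Suc i) h = (layer_label v u w i h + 1) mod 3" for i h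
    using that pV[of i] pV[of "Suc i"] pE(1)[OF that(1)]
    by (simp add: label_arcs_def K_def cart_prod_def fi)
  have ver': "((p ! Suc i, h), (p ! i, h)) \<in> label_arcs K f"
    if "Suc i < n" "h \<in> pverts H" "layer_label v u w i h = (layer_label v u w (Suc i) h + 1) mod 3" for i h
    using that pV[of i] pV[of "Suc i"] pE(2)[OF that(1)]
    by (simp add: label_arcs_def K_def cart_prod_def fi)
  have tpcon: "total_proper_connected K f (third_colour f)"
  proof (rule total_proper_connected_label[OF K lt])
    fix y z assume y: "y \<in> pverts K" and z: "z \<in> pverts K"
    obtain i h where i: "i < n" "h \<in> pverts H" "y = (p ! i, h)"
      using y unfolding KV p(2)[symmetric] by (auto simp: in_set_conv_nth n_def)
    obtain j k where j: "j < n" "k \<in> pverts H" "z = (p ! j, k)"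
      using z unfolding KV p(2)[symmetric] by (auto simp: in_set_conv_nth n_def)
    show "(y, z) \<in> (label_arcs K f)\<^sup>* \<or> (z, y) \<in> (label_arcs K f)\<^sup>*"
      unfolding i(3) j(3)
      by (rule grid_unilateral[where c = "\<lambda>i h. (p ! i, h)", OF n inV dist nb' wu hor ver ver'
            i(1) j(1) i(2) j(2)])
  qed
  \<comment> \<open>The copies of \<open>v\<close> and \<open>w\<close> in the first layer are
    distinct and non-adjacent.\<close>
  have lower: "3 \<le> card (cv ` pverts K \<union> ce ` uedges K)" if "total_proper_connected K cv ce" for cv ce
  proof (rule three_colours_needed[OF K that])
    show "(p ! 0, v) \<in> pverts K" "(p ! 0, w) \<in> pverts K" using pV[of 0] n inV by (auto simp: KV)
    show "(p ! 0, v) \<noteq> (p ! 0, w)" using dist by simp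
    show "((p ! 0, v), (p ! 0, w)) \<notin> parcs K" using vw dist by (auto simp: K_def cart_prod_def)
  qed
  \<comment> \<open>Labels and edge colours are all residues modulo 3; with the lower bound, exactly
    three colours occur.\<close>
  have "f ` pverts K \<union> third_colour f ` uedges K \<subseteq> {..<3}"
    using lt by (auto simp: third_colour_def)
  from card_mono[OF _ this] have "card (f ` pverts K \<union> third_colour f ` uedges K) \<le> 3" by simp
  with lower[OF tpcon] have "card (f ` pverts K \<union> third_colour f ` uedges K) = 3" by simp
  with tpcon have "\<exists>cv ce. total_proper_connected K cv ce \<and> card (cv ` pverts K \<union> ce ` uedges K) = 3"
    by blast
  then show ?thesis
    unfolding tpc_def K_def[symmetric] using lower by (intro Least_equality) blast+
qed

end
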